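(* $z_{6,3}=2/3$.
   Context: $K_n^r$ denotes the complete $r$-uniform hypergraph on $n$ vertices. Given an edge-coloring $c$ (an arbitrary assignment of colors to edges) of $K_n^r$, let $z(n,r,c,s)$ be the fraction of the $n$ vertices that are incident with at least one edge of color $s$, and let $z(n,r,c)$ be the maximum of $z(n,r,c,s)$ over all colors $s$ appearing in $c$. Let $z_k(n,r)$ be the minimum of $z(n,r,c)$ over all edge-colorings $c$ of $K_n^r$ that use at most $k$ colors, and let $z_{k,r}=\inf_{n\ge r} z_k(n,r)$. *)

theory Defs
  imports Complex_Main "HOL-Library.Ramsey"
begin

text \<open>The vertices of the complete \<open>r\<close>-uniform hypergraph on \<open>n\<close> vertices are \<open>{..<n}\<close>.\<close>

definition complete_edges :: "nat \<Rightarrow> nat \<Rightarrow> nat set set" where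
  "complete_edges n r = nsets {..<n} r"

text \<open>
  An edge-coloring is a function \<open>c :: nat set \<Rightarrow> nat\<close>, of which only the restriction to the
  edges matters. Since only finitely many colors occur on the finitely many edges,
  taking colors in \<open>nat\<close> is no restriction.
\<close>

definition colors :: "nat \<Rightarrow> nat \<Rightarrow> (nat set \<Rightarrow> nat) \<Rightarrow> nat set" where
  "colors n r c = c ` complete_edges n r"

definition z_color :: "nat \<Rightarrow> nat \<Rightarrow> (nat set \<Rightarrow> nat) \<Rightarrow> nat \<Rightarrow> real" where
  "z_color n r c s =
     real (card {v \<in> {..<n}. \<exists>e \<in> complete_edges n r. v \<in> e \<and> c e = s}) / real n"

definition z_coloring :: "nat \<Rightarrow> nat \<Rightarrow> (nat set \<Rightarrow> nat) \<Rightarrow> real" where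
  "z_coloring n r c = Max (z_color n r c ` colors n r c)"

text \<open>
  There are infinitely many functions \<open>c\<close>, but for \<open>1 \<le> r \<le> n\<close> and \<open>1 \<le> k\<close> the set of values
  below is a nonempty subset of \<open>{i / n | i. i \<le> n}\<close>, so that the minimum exists.
\<close>

definition z_min :: "nat \<Rightarrow> nat \<Rightarrow> nat \<Rightarrow> real" where
  "z_min k n r = Min (z_coloring n r ` {c. card (colors n r c) \<le> k})"

definition z_inf :: "nat \<Rightarrow> nat \<Rightarrow> real" where
  "z_inf k r = (INF n\<in>{r..}. z_min k n r)"

end

theory Submission
  imports Defs
begin

text \<open>
  For the lower bound, give each vertex \<open>v\<close> the set \<open>T v\<close> of colors that are \<^emph>\<open>missing\<close> at
  \<open>v\<close>. The color of an edge is missing at none of its vertices, so no three of the sets \<open>T v\<close>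
  cover the set \<open>C\<close> of six colors, and the task is to find a color missing at no more than a third
  of the vertices. Averaging over a suitable set of colors does this
  (\<open>exists_rarely_missing_color\<close>). If every color is missing somewhere, then no
  \<open>T v\<close> contains four colors, as two further vertices would take care of the remaining two.
  If every \<open>T v\<close> has at most two of the six colors, average over all of \<open>C\<close>. If some
  \<open>T u\<close> has three colors, then no \<open>T v\<close> contains two of the other three colors, since \<open>u\<close>,
  \<open>v\<close> and one more vertex would cover \<open>C\<close>; so average over these other three.

  For the upper bound, equality in the first average suggests six vertices with two missing colors
  each: regard the six vertices as the edges of a graph on the six colors. This graph should be
  2-regular and without perfect matching, so it is a pair of disjoint triangles
  (\<open>two_triangle_coloring\<close>).
\<close>

section \<open>Three sets that do not cover six points\<close>

text \<open>
  Count the pairs of a point \<open>v\<close> and a color of \<open>B\<close> missing at \<open>v\<close> in two ways: there are at most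
  \<open>m * card V\<close> of them, spread over \<open>3 * m\<close> colors.
\<close>

lemma exists_color_below_average:
  fixes T :: "'a \<Rightarrow> 'b set"
  assumes "finite V" and B: "card B = 3 * m" "m > 0"
    and le: "\<And>v. v \<in> V \<Longrightarrow> card (B \<inter> T v) \<le> m"
  shows "\<exists>s\<in>B. 3 * card {v \<in> V. s \<in> T v} \<le> card V"
proof (rule ccontr)
  assume "\<not> ?thesis"
  then have gt: "\<And>s. s \<in> B \<Longrightarrow> card V < 3 * card {v \<in> V. s \<in> T v}"
    by force
  have "finite B" "B \<noteq> {}"
    using B by (auto intro: card_ge_0_finite)
  then have "card B * card V < (\<Sum>s\<in>B. 3 * card {v \<in> V. s \<in> T v})"
    using sum_strict_mono[of B "\<lambda>_. card V"] gt by simp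
  also have "\<dots> = 3 * (\<Sum>s\<in>B. card {v \<in> V. s \<in> T v})"
    by (simp add: sum_distrib_left)
  also have "(\<Sum>s\<in>B. card {v \<in> V. s \<in> T v}) = (\<Sum>v\<in>V. card {s \<in> B. s \<in> T v})"
    using sum_multicount_gen[OF \<open>finite B\<close> \<open>finite V\<close>, of "\<lambda>s v. s \<in> T v"] by simp
  also have "\<dots> \<le> (\<Sum>v\<in>V. m)"
    using le by (intro sum_mono) (simp add: Int_def)
  finally show False
    using B by (simp add: mult_ac)
qed

text \<open>
  The average is taken over all of \<open>C\<close>, or over the complement of a three-element \<open>C \<inter> T u\<close>. In the
  second case the three colors of \<open>T u\<close> themselves may be missing at almost all vertices, so that
  an average over all of \<open>C\<close> would fail.
\<close>

lemma exists_rarely_missing_color: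
  fixes T :: "'a \<Rightarrow> 'b set"
  assumes "finite V" and C: "card C = 6"
    and no_cover: "\<And>u v w. \<lbrakk>u \<in> V; v \<in> V; w \<in> V\<rbrakk> \<Longrightarrow> \<not> C \<subseteq> T u \<union> T v \<union> T w"
  shows "\<exists>s\<in>C. 3 * card {v \<in> V. s \<in> T v} \<le> card V"
proof (cases "\<forall>s\<in>C. \<exists>v\<in>V. s \<in> T v")
  case False
  then obtain s where "s \<in> C" "{v \<in> V. s \<in> T v} = {}" by blast
  then show ?thesis by (metis card.empty le0 mult_0_right)
next
  case hit: True
  have "finite C" using C by (simp add: card_ge_0_finite)
  have rest: "card (C - T v) \<ge> 3" if "v \<in> V" for v
  proof (rule ccontr)
    assume "\<not> ?thesis"
    then have "card (C - T v) \<le> 2" by simp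
    moreover have "C - T v \<noteq> {}"
      using no_cover[OF that that that] by blast
    ultimately have "card (C - T v) = 1 \<or> card (C - T v) = 2"
      using \<open>finite C\<close> card_gt_0_iff[of "C - T v"] by force
    then obtain a b where ab: "C - T v = {a, b}"
      by (metis card_1_singletonE card_2_iff insert_absorb2)
    then obtain x y where "x \<in> V" "a \<in> T x" "y \<in> V" "b \<in> T y"
      using hit by blast
    then show False
      using no_cover[OF that \<open>x \<in> V\<close> \<open>y \<in> V\<close>] ab by auto
  qed
  show ?thesis
  proof (cases "\<forall>v\<in>V. card (C \<inter> T v) \<le> 2")
    case True
    then show ?thesis
      using exists_color_below_average[of V C 2 T] \<open>finite V\<close> C by simp
  next
    case False
    then obtain u where u: "u \<in> V" "card (C \<inter> T u) \<ge> 3"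
      by force
    define B where "B = C - T u"
    have "card B = 3"
      using rest[OF u(1)] u(2) C \<open>finite C\<close> card_Int_Diff[of C "T u"] by (simp add: B_def)
    have "card (B \<inter> T v) \<le> 1" if "v \<in> V" for v
    proof (rule ccontr)
      assume "\<not> ?thesis"
      moreover have "card (B \<inter> T v) + card (B - T v) = 3"
        using \<open>card B = 3\<close> \<open>finite C\<close> card_Int_Diff[of B "T v"] by (simp add: B_def)
      ultimately have "card (B - T v) \<le> 1" by linarith
      moreover have "B - T v \<noteq> {}"
        using no_cover[OF u(1) that that] by (auto simp: B_def)
      ultimately have "card (B - T v) = 1"
        using \<open>finite C\<close> card_gt_0_iff[of "B - T v"] by (force simp: B_def)
      then obtain a where a: "B - T v = {a}"
        by (rule card_1_singletonE)
      then obtain w where "w \<in> V" "a \<in> T w"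
        using hit by (auto simp: B_def)
      then show False
        using no_cover[OF u(1) that \<open>w \<in> V\<close>] a by (auto simp: B_def)
    qed
    then have "\<exists>s\<in>B. 3 * card {v \<in> V. s \<in> T v} \<le> card V"
      using exists_color_below_average[of V B 1 T] \<open>finite V\<close> \<open>card B = 3\<close> by simp
    then show ?thesis by (auto simp: B_def)
  qed
qed

section \<open>The extrema in the definitions\<close>

lemma complete_edges_iff: "e \<in> complete_edges n r \<longleftrightarrow> e \<subseteq> {..<n} \<and> card e = r \<and> finite e"
  by (auto simp: complete_edges_def nsets_def)

lemma finite_colors: "finite (colors n r c)"
  by (simp add: colors_def complete_edges_def finite_imp_finite_nsets)

lemma colors_nonempty: "r \<le> n \<Longrightarrow> colors n r c \<noteq> {}"
proof -
  assume "r \<le> n"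
  then have "{..<r} \<in> complete_edges n r"
    by (auto simp: complete_edges_iff)
  then show ?thesis by (auto simp: colors_def)
qed

lemma finite_z_colorings:
  assumes "r \<le> n"
  shows "finite (z_coloring n r ` S)"
proof (rule finite_subset)
  show "z_coloring n r ` S \<subseteq> (\<lambda>i. real i / real n) ` {..n}"
  proof clarify
    fix c
    have "z_coloring n r c \<in> z_color n r c ` colors n r c"
      unfolding z_coloring_def using finite_colors colors_nonempty[OF assms]
      by (intro Max_in) simp_all
    then obtain s where "z_coloring n r c = z_color n r c s"
      by (rule imageE)
    moreover have "z_color n r c s \<in> (\<lambda>i. real i / real n) ` {..n}"
    proof -
      have "card {v \<in> {..<n}. P v} \<le> n" for P
        using card_mono[of "{..<n}" "{v \<in> {..<n}. P v}"] by auto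
      then show ?thesis
        unfolding z_color_def by (intro imageI) (simp only: atMost_iff)
    qed
    ultimately show "z_coloring n r c \<in> (\<lambda>i. real i / real n) ` {..n}" by (simp only:)
  qed
qed simp

section \<open>Some color covers two thirds of the vertices\<close>

lemma z_coloring_ge_two_thirds:
  assumes n: "n \<ge> 3" and k: "card (colors n 3 c) \<le> 6"
  shows "z_coloring n 3 c \<ge> 2 / 3"
proof -
  define T where "T v = {s. \<not> (\<exists>e \<in> complete_edges n 3. v \<in> e \<and> c e = s)}" for v
  \<comment> \<open>Colors that do not occur are missing everywhere, so they may pad the set of colors
    to exactly six.\<close>
  obtain D where D: "D \<subseteq> - colors n 3 c" "finite D" "card D = 6 - card (colors n 3 c)"
    using infinite_arbitrarily_large[of "- colors n 3 c"] finite_colors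
    by (metis finite_compl infinite_UNIV_nat)
  define C where "C = colors n 3 c \<union> D"
  have "card C = card (colors n 3 c) + card D"
    unfolding C_def using D by (intro card_Un_disjoint finite_colors) auto
  then have C: "colors n 3 c \<subseteq> C" "card C = 6"
    using D(3) k by (auto simp: C_def)
  have "\<not> C \<subseteq> T u \<union> T v \<union> T w" if uvw: "u < n" "v < n" "w < n" for u v w
  proof
    assume cover: "C \<subseteq> T u \<union> T v \<union> T w"
    \<comment> \<open>The three vertices need not be distinct, but they lie in a common edge.\<close>
    have "card {u, v, w} \<le> 3"
      by (simp add: card_insert_if)
    then obtain e where e: "{u, v, w} \<subseteq> e" "e \<subseteq> {..<n}" "card e = 3"
      using exists_subset_between[of "{u, v, w}" 3 "{..<n}"] uvw n by auto
    then have edge: "e \<in> complete_edges n 3"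
      by (simp add: complete_edges_iff finite_subset[OF e(2)])
    then have "c e \<in> C" using C by (auto simp: colors_def)
    with cover edge e(1) show False by (auto simp: T_def)
  qed
  then obtain s where s: "s \<in> C" "3 * card {v \<in> {..<n}. s \<in> T v} \<le> n"
    using exists_rarely_missing_color[of "{..<n}" C T] C(2) by auto
  define A where "A = {v \<in> {..<n}. \<exists>e \<in> complete_edges n 3. v \<in> e \<and> c e = s}"
  have "A \<subseteq> {..<n}"
    by (auto simp: A_def)
  have "{v \<in> {..<n}. s \<in> T v} = {..<n} - A"
    by (auto simp: A_def T_def)
  then have "card {v \<in> {..<n}. s \<in> T v} = n - card A"
    using card_Diff_subset[OF _ \<open>A \<subseteq> {..<n}\<close>] finite_subset[OF \<open>A \<subseteq> {..<n}\<close>] by simp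
  moreover have "card A \<le> n"
    using card_mono[OF _ \<open>A \<subseteq> {..<n}\<close>] by simp
  ultimately have two_thirds: "2 * n \<le> 3 * card A"
    using s(2) by linarith
  then have "A \<noteq> {}" using n by auto
  then have "s \<in> colors n 3 c" by (auto simp: A_def colors_def)
  then have "z_color n 3 c s \<le> z_coloring n 3 c"
    unfolding z_coloring_def by (simp add: finite_colors)
  moreover have "2 / 3 \<le> z_color n 3 c s"
    using two_thirds n unfolding z_color_def A_def[symmetric] by (simp add: field_simps)
  ultimately show ?thesis by linarith
qed

section \<open>Two disjoint triangles\<close>

text \<open>
  The colors are the vertices of the triangles \<open>{0,1,2}\<close> and \<open>{3,4,5}\<close>; the vertex \<open>v\<close> of the
  hypergraph is the side opposite to the color \<open>v\<close>, and it misses the two ends of this side.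
  Three sides never cover all colors: one triangle contains at most one of them, and then
  the color opposite to this side remains, or the whole triangle if it contains none of them.
\<close>

lemma two_triangle_coloring:
  "\<exists>c. \<forall>e \<in> complete_edges 6 3. c e < 6 \<and> (\<forall>v\<in>e. v div 3 = c e div 3 \<longrightarrow> v = c e)"
proof (intro bchoice ballI)
  fix e assume edge: "e \<in> complete_edges 6 3"
  have e: "e \<subseteq> {..<6}" "card e = 3" "finite e"
    using edge by (auto simp: complete_edges_iff)
  define E where "E i = {v \<in> e. v div 3 = i}" for i
  have fin: "finite (E i)" for i
    using e by (simp add: E_def)
  have "E 0 \<inter> E 1 = {}" "E 0 \<union> E 1 \<subseteq> e"
    by (auto simp: E_def)
  then have "card (E 0) + card (E 1) \<le> 3"
    using card_Un_disjoint[OF fin fin, of 0 1] card_mono[OF e(3), of "E 0 \<union> E 1"] e(2) by simp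
  then have "card (E 0) \<le> 1 \<or> card (E 1) \<le> 1"
    by linarith
  then obtain i where i: "i < 2" "card (E i) \<le> 1"
    by (metis one_less_numeral_iff pos2 semiring_norm(76))
  show "\<exists>s. s < 6 \<and> (\<forall>v\<in>e. v div 3 = s div 3 \<longrightarrow> v = s)"
  proof (cases "E i = {}")
    case True
    then have "\<forall>v\<in>e. v div 3 \<noteq> i" by (simp add: E_def)
    then show ?thesis
      using i(1) by (intro exI[of _ "3 * i"]) simp
  next
    case False
    then obtain s where "s \<in> E i" by blast
    with i fin have "\<forall>v\<in>E i. v = s"
      by (simp add: card_le_Suc0_iff_eq)
    moreover have "s < 6" "s div 3 = i"
      using \<open>s \<in> E i\<close> e(1) unfolding E_def by blast+
    ultimately show ?thesis
      unfolding E_def by blast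
  qed
qed

lemma exists_two_thirds_coloring:
  "\<exists>c. card (colors 6 3 c) \<le> 6 \<and> z_coloring 6 3 c \<le> 2 / 3"
proof -
  obtain c :: "nat set \<Rightarrow> nat" where
    c: "\<forall>e \<in> complete_edges 6 3. c e < 6 \<and> (\<forall>v\<in>e. v div 3 = c e div 3 \<longrightarrow> v = c e)"
    using two_triangle_coloring by blast
  have sub: "colors 6 3 c \<subseteq> {..<6}"
    using c by (auto simp: colors_def)
  have "z_color 6 3 c s \<le> 2 / 3" if "s < 6" for s
  proof -
    let ?A = "{v \<in> {..<6}. \<exists>e \<in> complete_edges 6 3. v \<in> e \<and> c e = s}"
    let ?R = "{v \<in> {..<6}. v div 3 = s div 3 \<longrightarrow> v = s}"
    have "?A \<subseteq> ?R"
      using c by blast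
    then have "card ?A \<le> card ?R"
      by (rule card_mono[rotated]) simp
    also have "\<dots> = 4"
    proof -
      have "card ?R = (\<Sum>v<6. of_bool (v div 3 = s div 3 \<longrightarrow> v = s))"
        by (simp only: sum_of_bool_eq finite_lessThan of_nat_id Int_def mem_Collect_eq)
      also have "\<dots> = 4"
      proof -
        have six: "{..<6::nat} = {0, 1, 2, 3, 4, 5}" by auto
        have "s = 0 \<or> s = 1 \<or> s = 2 \<or> s = 3 \<or> s = 4 \<or> s = 5"
          using that by linarith
        then show ?thesis
          unfolding six by (elim disjE) (simp_all del: sum_of_bool_eq)
      qed
      finally show ?thesis .
    qed
    finally show ?thesis
      by (simp add: z_color_def)
  qed
  then have "z_coloring 6 3 c \<le> 2 / 3"
    unfolding z_coloring_def using sub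
    by (subst Max_le_iff) (auto simp: finite_colors colors_nonempty)
  moreover have "card (colors 6 3 c) \<le> 6"
    using card_mono[OF _ sub] by simp
  ultimately show ?thesis by blast
qed

theorem proposition2p9: "z_inf 6 3 = 2 / 3"
proof (rule antisym)
  obtain c where c: "card (colors 6 3 c) \<le> 6" "z_coloring 6 3 c \<le> 2 / 3"
    using exists_two_thirds_coloring by blast
  have ge: "z_min 6 n 3 \<ge> 2 / 3" if "n \<ge> 3" for n
  proof -
    have "card (colors n 3 (\<lambda>_. 0)) \<le> 6"
      by (rule order.trans[OF card_mono[of "{0}"]]) (auto simp: colors_def)
    then have "{c. card (colors n 3 c) \<le> 6} \<noteq> {}" by blast
    then show ?thesis
      unfolding z_min_def
    proof (intro Min.boundedI)
      show "finite (z_coloring n 3 ` {c. card (colors n 3 c) \<le> 6})"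
        using that by (rule finite_z_colorings)
    qed (use that z_coloring_ge_two_thirds in \<open>auto simp only: mem_Collect_eq\<close>)
  qed
  have "z_inf 6 3 \<le> z_min 6 6 3"
    unfolding z_inf_def
  proof (rule cINF_lower)
    show "bdd_below ((\<lambda>n. z_min 6 n 3) ` {3..})"
      using ge by (intro bdd_belowI2[of _ "2 / 3"]) (simp only: atLeast_iff)
  qed simp
  also have "\<dots> \<le> z_coloring 6 3 c"
    unfolding z_min_def using c(1) by (intro Min_le finite_z_colorings) simp_all
  also note c(2)
  finally show "z_inf 6 3 \<le> 2 / 3" .
  show "2 / 3 \<le> z_inf 6 3"
    unfolding z_inf_def by (rule cINF_greatest[OF _ ge]) simp_all
qed

end
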